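(* Let $f$ be an entire function in $\mathcal{K}$ of finite order $\rho>0$, let $\rho(t)$ be a proximate $\rho$-order, and let $\tau>0$. Then $$\lim_{t\to\infty}\frac{\ln f(t)}{t^{\rho(t)}}=\tau\qquad\text{if and only if}\qquad\lim_{t\to\infty}\frac{m_f(t)}{t^{\rho(t)}}=\tau\rho.$$ Moreover, if either of these two limit conditions holds, then $f$ is a clan.
   Context: $\mathcal{K}$ is the class of nonconstant power series $f(z)=\sum_{n=0}^\infty a_nz^n$ with positive radius of convergence $R\le\infty$, with all $a_n\ge 0$ and with $a_0>0$; $f$ entire means $R=\infty$. The associated (Khinchin) family $(X_t)_{t\ge 0}$ of an entire $f\in\mathcal{K}$ consists of random variables with values in $\{0,1,2,\dots\}$, with $X_0\equiv 0$ and $\mathbf{P}(X_t=n)=a_nt^n/f(t)$ for $t>0$, $n\ge 0$. Write $m_f(t)=\mathbf{E}(X_t)=tf'(t)/f(t)$ and $\sigma_f^2(t)=\mathbf{V}(X_t)=t\,m_f'(t)$, with $\sigma_f(t)\ge0$. An entire $f\in\mathcal{K}$ is a clan if $\lim_{t\to\infty}\sigma_f(t)/m_f(t)=0$. The order of $f$ is $\limsup_{t\to\infty}\frac{\ln\ln f(t)}{\ln t}$. For $\rho\ge 0$, a proximate $\rho$-order is a continuously differentiable function $\rho(t)$ defined on $(0,+\infty)$ such that $\lim_{t\to\infty}\rho(t)=\rho$ and $\lim_{t\to\infty}\rho'(t)\,t\ln t=0$. *)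

theory Defs
  imports "HOL-Probability.Probability"
begin

definition khinchin_class :: "real fps set" where
  "khinchin_class = {f. fps_conv_radius f > 0 \<and> (\<forall>n. fps_nth f n \<ge> 0) \<and>
                        fps_nth f 0 > 0 \<and> (\<exists>n>0. fps_nth f n \<noteq> 0)}"

definition entire :: "real fps \<Rightarrow> bool" where
  "entire f \<longleftrightarrow> fps_conv_radius f = \<infinity>"

text \<open>
  Only the distributions of the variables \<open>X\<^sub>t\<close> matter, so the family is represented by
  these. Since \<open>0 ^ 0 = 1\<close>, the formula below also yields the point mass at \<open>0\<close> for \<open>t = 0\<close>.
  That \<^const>\<open>embed_pmf\<close> is applied to a genuine mass function is lemma \<open>pmf_khinchin_pmf\<close>.
\<close>
definition khinchin_pmf :: "real fps \<Rightarrow> real \<Rightarrow> nat pmf" where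
  "khinchin_pmf f t = embed_pmf (\<lambda>n. fps_nth f n * t ^ n / eval_fps f t)"

lemma pmf_khinchin_pmf:
  assumes f: "f \<in> khinchin_class" and t: "t \<ge> 0" "ereal t < fps_conv_radius f"
  shows "pmf (khinchin_pmf f t) n = fps_nth f n * t ^ n / eval_fps f t"
proof -
  have nn: "fps_nth f n * t ^ n \<ge> 0" for n
    using f t by (auto simp: khinchin_class_def)
  have sums: "(\<lambda>n. fps_nth f n * t ^ n) sums eval_fps f t"
    using t by (intro sums_eval_fps) auto
  have "fps_nth f 0 * t ^ 0 \<le> eval_fps f t"
    using sum_le_suminf[OF sums_summable[OF sums], of "{0}"] nn
    unfolding sums_unique[OF sums, symmetric] by simp
  hence pos: "eval_fps f t > 0"
    using f by (auto simp: khinchin_class_def)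
  have sums1: "(\<lambda>n. fps_nth f n * t ^ n / eval_fps f t) sums 1"
    using sums_divide[OF sums, of "eval_fps f t"] pos by simp
  have nn1: "fps_nth f n * t ^ n / eval_fps f t \<ge> 0" for n
    using nn[of n] pos by simp
  have "(\<integral>\<^sup>+ n. ennreal (fps_nth f n * t ^ n / eval_fps f t) \<partial>count_space UNIV) = 1"
  proof -
    have "(\<integral>\<^sup>+ n. ennreal (fps_nth f n * t ^ n / eval_fps f t) \<partial>count_space UNIV) =
            (\<Sum>n. ennreal (fps_nth f n * t ^ n / eval_fps f t))"
      by (rule nn_integral_count_space_nat)
    also have "\<dots> = ennreal 1"
      by (rule suminf_ennreal_eq[OF nn1 sums1])
    finally show ?thesis by simp
  qed
  thus ?thesis
    unfolding khinchin_pmf_def by (rule pmf_embed_pmf[OF nn1])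
qed

definition khinchin_mean :: "real fps \<Rightarrow> real \<Rightarrow> real" where
  "khinchin_mean f t = measure_pmf.expectation (khinchin_pmf f t) real"

definition khinchin_sd :: "real fps \<Rightarrow> real \<Rightarrow> real" where
  "khinchin_sd f t = sqrt (measure_pmf.variance (khinchin_pmf f t) real)"

definition clan :: "real fps \<Rightarrow> bool" where
  "clan f \<longleftrightarrow> f \<in> khinchin_class \<and> entire f \<and>
     ((\<lambda>t. khinchin_sd f t / khinchin_mean f t) \<longlongrightarrow> 0) at_top"

definition entire_order :: "real fps \<Rightarrow> ereal" where
  "entire_order f = Limsup at_top (\<lambda>t::real. ereal (ln (ln (eval_fps f t)) / ln t))"

definition proximate_order :: "real \<Rightarrow> (real \<Rightarrow> real) \<Rightarrow> bool" where
  "proximate_order \<rho> r \<longleftrightarrow> \<rho> \<ge> 0 \<and> r C1_differentiable_on {0<..} \<and>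
     (r \<longlongrightarrow> \<rho>) at_top \<and> ((\<lambda>t. deriv r t * t * ln t) \<longlongrightarrow> 0) at_top"

end

theory Submission
  imports Defs
begin

text \<open>
  Put \<open>G(s) = ln f(e\<^sup>s)\<close>, \<open>V(s) = e\<^bsup>s r(e\<^sup>s)\<^esup>\<close> and \<open>m(s) = m\<^sub>f(e\<^sup>s)\<close>. Then \<open>G' = m\<close>, and the
  proximate order condition says \<open>V'/V \<longlongrightarrow> \<rho>\<close>, hence \<open>V(s + c)/V(s) \<longlongrightarrow> e\<^bsup>\<rho>c\<^esup>\<close>. If \<open>m/V \<longlongrightarrow> \<tau>\<rho>\<close>,
  l'Hopital's rule gives \<open>G/V \<longlongrightarrow> \<tau>\<close>. Conversely, Jensen's inequality gives
  \<open>c m(s) \<le> G(s + c) - G(s)\<close> for \<open>c\<close> of either sign, so \<open>m/V\<close> is asymptotically squeezed by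
  \<open>\<tau> (e\<^bsup>\<rho>c\<^esup> - 1)/c\<close> for small \<open>c\<close>.

  For the clan property, let \<open>\<theta> = t d/dt\<close>. Since \<open>ln (\<theta>f) = ln f + ln m\<^sub>f \<sim> ln f\<close>, the direct
  implication also applies to \<open>\<theta>f\<close>. Hence \<open>E(X\<^sub>t\<^sup>2) = (\<theta>\<theta>f/\<theta>f) (\<theta>f/f) \<sim> m\<^sub>f\<^sup>2\<close>, which is
  \<open>\<sigma>\<^sub>f\<^sup>2 = o(m\<^sub>f\<^sup>2)\<close>.
\<close>

section \<open>Functions with asymptotically constant logarithmic derivative\<close>

text \<open>Mean value inequality for \<open>h s - l * s\<close>, whose derivative
  \<open>h' s - l\<close> is eventually small. Applied to the logarithm of a function
  \<open>V\<close>, it turns a limit of \<open>V'/V\<close> into a limit of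
  \<open>V (s + c) / V s\<close>.\<close>

lemma tendsto_shift_diff_of_deriv:
  fixes h h' :: "real \<Rightarrow> real"
  assumes deriv: "\<forall>\<^sub>F s in at_top. (h has_real_derivative h' s) (at s)"
    and lim: "(h' \<longlongrightarrow> l) at_top"
  shows "((\<lambda>s. h (s + c) - h s) \<longlongrightarrow> l * c) at_top"
proof (rule tendstoI)
  fix e :: real assume "e > 0"
  define d where "d = e / (\<bar>c\<bar> + 1)"
  have d: "d > 0" "d * \<bar>c\<bar> < e"
    using \<open>e > 0\<close> by (auto simp: d_def field_simps)
  have "\<forall>\<^sub>F s in at_top. (h has_real_derivative h' s) (at s) \<and> dist (h' s) l < d"
    using deriv tendstoD[OF lim d(1)] by (rule eventually_conj)
  then obtain S where S: "\<And>s. s \<ge> S \<Longrightarrow> (h has_real_derivative h' s) (at s) \<and> dist (h' s) l < d"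
    by (auto simp: eventually_at_top_linorder)
  \<comment> \<open>This margin keeps both \<open>s\<close> and \<open>s + c\<close> in
    \<open>{S..}\<close>, whatever the sign of \<open>c\<close>.\<close>
  have bound: "dist (h (s + c) - h s) (l * c) < e" if "s \<ge> S + \<bar>c\<bar>" for s
  proof -
    have "norm ((h (s + c) - l * (s + c)) - (h s - l * s)) \<le> d * norm ((s + c) - s)"
    proof (rule field_differentiable_bound[where S = "{S..}" and f' = "\<lambda>s. h' s - l"])
      show "((\<lambda>s. h s - l * s) has_field_derivative h' z - l) (at z within {S..})"
        if "z \<in> {S..}" for z
      proof -
        have [derivative_intros]: "(h has_real_derivative h' z) (at z within {S..})"
          using S[of z] that by (auto intro: DERIV_subset)
        show ?thesis by (auto intro!: derivative_eq_intros)
      qed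
    qed (use that S in \<open>auto simp: dist_real_def intro: less_imp_le\<close>)
    thus ?thesis
      using d by (simp add: dist_real_def algebra_simps)
  qed
  show "\<forall>\<^sub>F s in at_top. dist (h (s + c) - h s) (l * c) < e"
    using eventually_ge_at_top[of "S + \<bar>c\<bar>"] by eventually_elim (rule bound)
qed

text \<open>For \<open>c > 0\<close> the support inequality bounds \<open>m s\<close> above by the
  difference quotient of \<open>G\<close>, for \<open>c < 0\<close> below. With \<open>c\<close>
  fixed, this quotient divided by \<open>V s\<close> tends to \<open>q c\<close>; only afterwards is
  \<open>c\<close> taken close to 0.\<close>

lemma tendsto_support_slope:
  fixes G V m :: "real \<Rightarrow> real"
  assumes V_pos: "\<And>s. V s > 0"
    and V: "\<And>c. ((\<lambda>s. V (s + c) / V s) \<longlongrightarrow> exp (\<rho> * c)) at_top"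
    and support: "\<And>s c. c * m s \<le> G (s + c) - G s"
    and G: "((\<lambda>s. G s / V s) \<longlongrightarrow> \<tau>) at_top"
  shows "((\<lambda>s. m s / V s) \<longlongrightarrow> \<tau> * \<rho>) at_top"
proof -
  define q where "q = (\<lambda>c::real. \<tau> * ((exp (\<rho> * c) - 1) / c))"
  \<comment> \<open>\<open>q\<close> is \<tau> times the difference quotient of
    \<open>exp (\<rho> * c)\<close> at 0, so its limit is \<tau> times that derivative.\<close>
  have "((\<lambda>c. exp (\<rho> * c)) has_real_derivative \<rho>) (at 0)"
    by (auto intro!: derivative_eq_intros)
  hence q: "(q \<longlongrightarrow> \<tau> * \<rho>) (at 0)"
    unfolding q_def by (intro tendsto_intros) (simp add: DERIV_def)
  have lim: "((\<lambda>s. (G (s + c) - G s) / V s / c) \<longlongrightarrow> q c) at_top" for c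
  proof -
    have shift: "filterlim (\<lambda>s::real. s + c) at_top at_top"
      by (subst add.commute) (intro filterlim_tendsto_add_at_top[OF tendsto_const] filterlim_ident)
    have "((\<lambda>s. (G (s + c) / V (s + c) * (V (s + c) / V s) - G s / V s) / c) \<longlongrightarrow>
             (\<tau> * exp (\<rho> * c) - \<tau>) / c) at_top"
      \<comment> \<open>For \<open>c = 0\<close> both sides are 0, since division by zero yields
        0.\<close>
      using filterlim_compose[OF G shift] V[of c] G
      by (cases "c = 0") (simp, intro tendsto_divide tendsto_diff tendsto_mult tendsto_const, auto)
    moreover have "V s \<noteq> 0" for s
      using V_pos[of s] by simp
    ultimately show ?thesis
      by (simp add: q_def diff_divide_distrib algebra_simps)
  qed
  show ?thesis
  proof (rule order_tendstoI)
    fix a assume "a < \<tau> * \<rho>"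
    have "\<forall>\<^sub>F c in at_left 0. a < q c \<and> c < 0"
      using order_tendstoD(1)[OF q \<open>a < \<tau> * \<rho>\<close>]
      by (auto simp: eventually_at_filter elim!: eventually_mono)
    then obtain c where c: "a < q c" "c < 0"
      using eventually_happens'[OF trivial_limit_at_left_real] by blast
    show "\<forall>\<^sub>F s in at_top. a < m s / V s"
      using order_tendstoD(1)[OF lim c(1)]
    proof eventually_elim
      case (elim s)
      have "(G (s + c) - G s) / c \<le> m s"
        using support[of c s] c by (simp add: neg_divide_le_eq mult.commute)
      hence "(G (s + c) - G s) / c / V s \<le> m s / V s"
        using V_pos[of s] by (intro divide_right_mono) auto
      hence "(G (s + c) - G s) / V s / c \<le> m s / V s"
        by (simp add: mult.commute)
      with elim show ?case by simp
    qed
  next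
    fix a assume "a > \<tau> * \<rho>"
    have "\<forall>\<^sub>F c in at_right 0. q c < a \<and> c > 0"
      using order_tendstoD(2)[OF q \<open>a > \<tau> * \<rho>\<close>]
      by (auto simp: eventually_at_filter elim!: eventually_mono)
    then obtain c where c: "q c < a" "c > 0"
      using eventually_happens'[OF trivial_limit_at_right_real] by blast
    show "\<forall>\<^sub>F s in at_top. m s / V s < a"
      using order_tendstoD(2)[OF lim c(1)]
    proof eventually_elim
      case (elim s)
      have "m s / V s \<le> (G (s + c) - G s) / V s / c"
        using support[of c s] V_pos[of s] c by (simp add: field_simps)
      with elim show ?case by simp
    qed
  qed
qed

lemma filterlim_exp_at_top_iff:
  "filterlim (\<lambda>s::real. g (exp s)) F at_top \<longleftrightarrow> filterlim g F at_top"
proof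
  assume "filterlim (\<lambda>s. g (exp s)) F at_top"
  hence "filterlim (\<lambda>t. g (exp (ln t))) F at_top"
    by (rule filterlim_compose[OF _ ln_at_top])
  moreover have "\<forall>\<^sub>F t::real in at_top. g (exp (ln t)) = g t"
    using eventually_gt_at_top[of 0] by eventually_elim simp
  ultimately show "filterlim g F at_top"
    by (simp add: filterlim_cong)
qed (rule filterlim_compose[OF _ exp_at_top])

text \<open>With \<open>V s = exp (s * r (exp s))\<close>, this is the derivative of
  \<open>ln V\<close>. Its second summand is \<open>r'(t) t ln t\<close> at
  \<open>t = exp s\<close>, exactly the quantity that a proximate order sends to 0.\<close>

lemma proximate_order_log_deriv:
  assumes "proximate_order \<rho> r"
  shows "((\<lambda>s. s * r (exp s)) has_real_derivative
           r (exp s) + deriv r (exp s) * exp s * s) (at s)"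
    and "((\<lambda>s. r (exp s) + deriv r (exp s) * exp s * s) \<longlongrightarrow> \<rho>) at_top"
proof -
  obtain D where "\<And>x. x > 0 \<Longrightarrow> (r has_vector_derivative D x) (at x)"
    using assms unfolding proximate_order_def C1_differentiable_on_def by auto
  hence D: "(r has_real_derivative D x) (at x)" if "x > 0" for x
    using that by (simp add: has_real_derivative_iff_has_vector_derivative)
  have [derivative_intros]: "(r has_real_derivative deriv r (exp s)) (at (exp s))"
    using D[of "exp s"] DERIV_imp_deriv[OF D[of "exp s"]] by simp
  have "((\<lambda>s. r (exp s)) has_real_derivative deriv r (exp s) * exp s) (at s)"
    by (rule DERIV_chain2) (auto intro!: derivative_eq_intros)
  thus "((\<lambda>s. s * r (exp s)) has_real_derivative
           r (exp s) + deriv r (exp s) * exp s * s) (at s)"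
    by (auto intro!: derivative_eq_intros)
  have "((\<lambda>t. r t + deriv r t * t * ln t) \<longlongrightarrow> \<rho> + 0) at_top"
    using assms unfolding proximate_order_def by (intro tendsto_add) auto
  from filterlim_compose[OF this exp_at_top]
  show "((\<lambda>s. r (exp s) + deriv r (exp s) * exp s * s) \<longlongrightarrow> \<rho>) at_top"
    by simp
qed

section \<open>Entire power series with nonnegative coefficients\<close>

lemma entire_sums:
  assumes "entire F"
  shows "(\<lambda>n. fps_nth F n * t ^ n) sums eval_fps F t"
  using assms by (intro sums_eval_fps) (simp add: entire_def)

text \<open>The Euler operator \<open>t d/dt\<close>. The quotient \<open>theta F / F\<close> is the
  derivative of \<open>ln F\<close> with respect to \<open>ln t\<close>, and iterating
  \<open>theta\<close> produces the moments.\<close>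

definition theta :: "real fps \<Rightarrow> real fps" where
  "theta F = fps_X * fps_deriv F"

lemma theta_nth: "fps_nth (theta F) n = real n * fps_nth F n"
  by (cases n) (simp_all add: theta_def)

lemma entire_deriv: "entire F \<Longrightarrow> entire (fps_deriv F)"
  using fps_conv_radius_deriv[of F] by (simp add: entire_def)

lemma entire_theta:
  assumes "entire F"
  shows "entire (theta F)"
  using fps_conv_radius_mult[of fps_X "fps_deriv F"] entire_deriv[OF assms]
  by (simp add: entire_def theta_def)

lemma eval_fps_theta:
  assumes "entire F"
  shows "eval_fps (theta F) t = t * eval_fps (fps_deriv F) t"
  using entire_deriv[OF assms] by (simp add: theta_def entire_def eval_fps_mult)

lemma eval_fps_pos:
  assumes "entire F" "\<And>n. fps_nth F n \<ge> 0" "fps_nth F k > 0" "t > 0"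
  shows "eval_fps F t > 0"
proof -
  have "0 < fps_nth F k * t ^ k"
    using assms by simp
  also have "\<dots> \<le> eval_fps F t"
    using sum_le_suminf[OF sums_summable[OF entire_sums[OF assms(1), of t]], of "{k}"] assms
    by (simp add: sums_unique[OF entire_sums[OF assms(1), of t], symmetric])
  finally show ?thesis .
qed

lemma ln_eval_fps_exp_deriv:
  assumes "entire F" "eval_fps F (exp s) > 0"
  shows "((\<lambda>s. ln (eval_fps F (exp s))) has_real_derivative
           eval_fps (theta F) (exp s) / eval_fps F (exp s)) (at s)"
proof -
  have "(eval_fps F has_real_derivative eval_fps (fps_deriv F) (exp s)) (at (exp s))"
    using assms by (intro has_field_derivative_eval_fps) (simp add: entire_def)
  hence "((\<lambda>s. eval_fps F (exp s)) has_real_derivative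
           eval_fps (fps_deriv F) (exp s) * exp s) (at s)"
    by (rule DERIV_chain2) (auto intro!: derivative_eq_intros)
  thus ?thesis
    using assms by (auto intro!: derivative_eq_intros simp: eval_fps_theta)
qed

text \<open>Jensen's inequality \<open>E(exp (c X)) \<ge> exp (c E(X))\<close> for the weights
  \<open>fps_nth F n * t ^ n / eval_fps F t\<close>, whose exponential moment is
  \<open>eval_fps F (t * exp c) / eval_fps F t\<close>.\<close>

lemma ln_eval_fps_exp_support:
  assumes F: "entire F" "\<And>n. fps_nth F n \<ge> 0" and pos: "\<And>t. t > 0 \<Longrightarrow> eval_fps F t > 0"
  shows "c * (eval_fps (theta F) (exp s) / eval_fps F (exp s))
           \<le> ln (eval_fps F (exp (s + c))) - ln (eval_fps F (exp s))"
proof -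
  define t m where "t = exp s" and "m = eval_fps (theta F) t / eval_fps F t"
  have "t > 0" by (simp add: t_def)
  note pos = pos[OF \<open>t > 0\<close>] pos[of "t * exp c"]
  \<comment> \<open>The tangent to \<open>exp (c * x)\<close> at the mean \<open>x = m\<close> lies
    below it; after summation over \<open>n\<close> its linear part cancels.\<close>
  have tangent: "fps_nth F n * t ^ n * (exp (c * m) * (1 + c * (real n - m)))
                   \<le> fps_nth F n * (t * exp c) ^ n" for n
  proof -
    have "exp (c * m) * (1 + c * (real n - m)) \<le> exp (c * m) * exp (c * (real n - m))"
      by (intro mult_left_mono exp_ge_add_one_self) auto
    also have "\<dots> = exp c ^ n"
      by (simp add: exp_add[symmetric] exp_of_nat_mult[symmetric] algebra_simps)
    finally have "fps_nth F n * t ^ n * (exp (c * m) * (1 + c * (real n - m)))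
                   \<le> fps_nth F n * t ^ n * exp c ^ n"
      using F(2)[of n] \<open>t > 0\<close> by (intro mult_left_mono) auto
    thus ?thesis by (simp add: power_mult_distrib mult.assoc)
  qed
  have "(\<lambda>n. exp (c * m) * (1 - c * m) * (fps_nth F n * t ^ n)
              + exp (c * m) * c * (fps_nth (theta F) n * t ^ n))
          sums (exp (c * m) * (1 - c * m) * eval_fps F t + exp (c * m) * c * eval_fps (theta F) t)"
    by (intro sums_add sums_mult entire_sums entire_theta F)
  also have "exp (c * m) * (1 - c * m) * eval_fps F t + exp (c * m) * c * eval_fps (theta F) t
               = exp (c * m) * eval_fps F t"
    using pos(1) by (simp add: m_def field_simps)
  finally have "(\<lambda>n. fps_nth F n * t ^ n * (exp (c * m) * (1 + c * (real n - m))))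
                  sums (exp (c * m) * eval_fps F t)"
    by (simp add: theta_nth algebra_simps)
  hence "exp (c * m) * eval_fps F t \<le> eval_fps F (t * exp c)"
    by (rule sums_le[OF tangent _ entire_sums[OF F(1)]])
  hence "ln (exp (c * m) * eval_fps F t) \<le> ln (eval_fps F (t * exp c))"
    using pos \<open>t > 0\<close> by simp
  thus ?thesis
    using pos(1) by (simp add: ln_mult m_def t_def exp_add)
qed

text \<open>Positivity for \<open>t > 0\<close> is assumed instead of membership in
  \<open>khinchin_class\<close>, because the lemma is also applied to \<open>theta f\<close>, whose
  constant coefficient is 0.\<close>

lemma theta_quotient_limit:
  assumes F: "entire F" "\<And>n. fps_nth F n \<ge> 0" "\<And>t. t > 0 \<Longrightarrow> eval_fps F t > 0"
    and r: "proximate_order \<rho> r"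
    and lim: "((\<lambda>t. ln (eval_fps F t) / t powr r t) \<longlongrightarrow> \<tau>) at_top"
  shows "((\<lambda>t. eval_fps (theta F) t / eval_fps F t / t powr r t) \<longlongrightarrow> \<tau> * \<rho>) at_top"
proof -
  define V where "V = (\<lambda>s. exp (s * r (exp s)))"
  have V_eq: "exp s powr r (exp s) = V s" for s
    by (simp add: V_def powr_def mult.commute)
  have V: "((\<lambda>s. V (s + c) / V s) \<longlongrightarrow> exp (\<rho> * c)) at_top" for c
  proof -
    have "((\<lambda>s. exp ((s + c) * r (exp (s + c)) - s * r (exp s))) \<longlongrightarrow> exp (\<rho> * c)) at_top"
      using proximate_order_log_deriv[OF r]
      by (intro tendsto_exp tendsto_shift_diff_of_deriv) auto
    thus ?thesis by (simp add: V_def exp_diff)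
  qed
  have "((\<lambda>s. eval_fps (theta F) (exp s) / eval_fps F (exp s) / V s) \<longlongrightarrow> \<tau> * \<rho>) at_top"
    using filterlim_compose[OF lim exp_at_top]
    by (intro tendsto_support_slope[OF _ V ln_eval_fps_exp_support[OF F]]) (auto simp: V_eq V_def)
  thus ?thesis
    by (subst filterlim_exp_at_top_iff[symmetric]) (simp add: V_eq)
qed

lemma proximate_order_powr_at_top:
  assumes "proximate_order \<rho> r" "\<rho> > 0"
  shows "filterlim (\<lambda>t. t powr r t) at_top at_top"
proof -
  have "filterlim (\<lambda>t. r t * ln t) at_top at_top"
    using assms unfolding proximate_order_def
    by (intro filterlim_tendsto_pos_mult_at_top[OF _ _ ln_at_top]) auto
  hence "filterlim (\<lambda>t. exp (r t * ln t)) at_top at_top"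
    by (rule filterlim_compose[OF exp_at_top])
  thus ?thesis
    by (rule filterlim_mono_eventually)
       (auto simp: powr_def intro: eventually_mono[OF eventually_gt_at_top[of 0]])
qed

text \<open>L'Hopital's rule in \<open>s = ln t\<close>: the quotient of derivatives is the given
  quotient divided by \<open>p = V'/V\<close>, and \<open>p\<close> tends to \<rho>.\<close>

lemma ln_eval_fps_limit:
  assumes F: "entire F" "\<And>t. t > 0 \<Longrightarrow> eval_fps F t > 0"
    and r: "proximate_order \<rho> r" "\<rho> > 0"
    and lim: "((\<lambda>t. eval_fps (theta F) t / eval_fps F t / t powr r t) \<longlongrightarrow> \<tau> * \<rho>) at_top"
  shows "((\<lambda>t. ln (eval_fps F t) / t powr r t) \<longlongrightarrow> \<tau>) at_top"
proof -
  define V where "V = (\<lambda>s. exp (s * r (exp s)))"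
  define p where "p = (\<lambda>s. r (exp s) + deriv r (exp s) * exp s * s)"
  have V_eq: "exp s powr r (exp s) = V s" for s
    by (simp add: V_def powr_def mult.commute)
  have p: "(p \<longlongrightarrow> \<rho>) at_top"
    unfolding p_def by (rule proximate_order_log_deriv[OF r(1)])
  have "((\<lambda>s. ln (eval_fps F (exp s)) / V s) \<longlongrightarrow> \<tau>) at_top"
  proof (rule lhospital_at_top_at_top)
    show "filterlim V at_top at_top"
      using filterlim_compose[OF proximate_order_powr_at_top[OF r] exp_at_top]
      by (simp add: V_eq)
    have "\<forall>\<^sub>F s in at_top. p s > 0"
      using p r(2) by (rule order_tendstoD)
    thus "\<forall>\<^sub>F s in at_top. V s * p s \<noteq> 0"
      by eventually_elim (simp add: V_def)
    show "\<forall>\<^sub>F s in at_top. ((\<lambda>s. ln (eval_fps F (exp s))) has_real_derivative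
            eval_fps (theta F) (exp s) / eval_fps F (exp s)) (at s)"
      using F by (intro always_eventually allI ln_eval_fps_exp_deriv) auto
    show "\<forall>\<^sub>F s in at_top. (V has_real_derivative V s * p s) (at s)"
      unfolding V_def p_def
      by (intro always_eventually allI DERIV_fun_exp proximate_order_log_deriv[OF r(1)])
    have "((\<lambda>s. eval_fps (theta F) (exp s) / eval_fps F (exp s) / V s / p s)
             \<longlongrightarrow> \<tau> * \<rho> / \<rho>) at_top"
      using filterlim_compose[OF lim exp_at_top] r(2) by (intro tendsto_divide p) (auto simp: V_eq)
    thus "((\<lambda>s. eval_fps (theta F) (exp s) / eval_fps F (exp s) / (V s * p s)) \<longlongrightarrow> \<tau>) at_top"
      using r(2) by (simp add: field_simps)
  qed
  thus ?thesis
    by (subst filterlim_exp_at_top_iff[symmetric]) (simp add: V_eq)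
qed

section \<open>Moments of the Khinchin family\<close>

text \<open>The measure has density \<open>pmf p\<close> with respect to counting measure, so the
  integral is a series; nonnegativity makes its convergence absolute.\<close>

lemma has_bochner_integral_nat_pmf:
  fixes p :: "nat pmf" and g :: "nat \<Rightarrow> real"
  assumes "\<And>n. g n \<ge> 0" "(\<lambda>n. pmf p n * g n) sums s"
  shows "has_bochner_integral (measure_pmf p) g s"
proof -
  have "integrable (count_space UNIV) (\<lambda>n. pmf p n * g n)"
    using assms by (auto simp: integrable_count_space_nat_iff abs_mult dest: sums_summable)
  moreover from this have "integral\<^sup>L (count_space UNIV) (\<lambda>n. pmf p n * g n) = s"
    using assms(2) sums_integral_count_space_nat sums_unique2 by blast
  ultimately have "has_bochner_integral (count_space UNIV) (\<lambda>n. pmf p n * g n) s"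
    by (simp add: has_bochner_integral_iff)
  thus ?thesis
    by (subst measure_pmf_eq_density, intro has_bochner_integral_density) auto
qed

lemma khinchin_moments:
  assumes f: "f \<in> khinchin_class" "entire f" and t: "t > 0"
  shows "khinchin_mean f t = eval_fps (theta f) t / eval_fps f t"
    and "khinchin_sd f t =
      sqrt (eval_fps (theta (theta f)) t / eval_fps f t - (khinchin_mean f t)\<^sup>2)"
proof -
  have pmf: "pmf (khinchin_pmf f t) n = fps_nth f n * t ^ n / eval_fps f t" for n
    using f t by (intro pmf_khinchin_pmf) (auto simp: entire_def)
  have "(\<lambda>n. fps_nth (theta f) n * t ^ n / eval_fps f t) sums (eval_fps (theta f) t / eval_fps f t)"
    by (intro sums_divide entire_sums entire_theta f)
  hence 1: "has_bochner_integral (khinchin_pmf f t) real (eval_fps (theta f) t / eval_fps f t)"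
    by (intro has_bochner_integral_nat_pmf) (simp_all add: pmf theta_nth algebra_simps)
  have "(\<lambda>n. fps_nth (theta (theta f)) n * t ^ n / eval_fps f t)
          sums (eval_fps (theta (theta f)) t / eval_fps f t)"
    by (intro sums_divide entire_sums entire_theta f)
  hence 2: "has_bochner_integral (khinchin_pmf f t) (\<lambda>n. (real n)\<^sup>2)
              (eval_fps (theta (theta f)) t / eval_fps f t)"
    by (intro has_bochner_integral_nat_pmf)
       (simp_all add: pmf theta_nth power2_eq_square algebra_simps)
  show "khinchin_mean f t = eval_fps (theta f) t / eval_fps f t"
    using 1 by (simp add: khinchin_mean_def has_bochner_integral_iff)
  show "khinchin_sd f t =
      sqrt (eval_fps (theta (theta f)) t / eval_fps f t - (khinchin_mean f t)\<^sup>2)"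
    using 1 2 unfolding khinchin_sd_def khinchin_mean_def
    by (subst measure_pmf.variance_eq) (auto simp: has_bochner_integral_iff)
qed

text \<open>The squared ratio of deviation to mean is \<open>(C/B) / (B/A) - 1\<close>, where
  \<open>A\<close>, \<open>B\<close>, \<open>C\<close> are \<open>f\<close>, \<open>theta f\<close>,
  \<open>theta (theta f)\<close>. Both quotients are asymptotic to
  \<open>\<tau> * \<rho> * V\<close>.\<close>

lemma khinchin_clan:
  assumes f: "f \<in> khinchin_class" "entire f"
    and r: "proximate_order \<rho> r" "\<rho> > 0" and "\<tau> > 0"
    and ln_lim: "((\<lambda>t. ln (eval_fps f t) / t powr r t) \<longlongrightarrow> \<tau>) at_top"
    and mean_lim: "((\<lambda>t. eval_fps (theta f) t / eval_fps f t / t powr r t) \<longlongrightarrow> \<tau> * \<rho>) at_top"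
  shows "clan f"
proof -
  define V where "V = (\<lambda>t. t powr r t)"
  define A B C where "A = eval_fps f" and "B = eval_fps (theta f)" and "C = eval_fps (theta (theta f))"
  note defs = V_def A_def B_def C_def
  have coeff: "fps_nth f n \<ge> 0" "fps_nth (theta f) n \<ge> 0" for n
    using f by (auto simp: khinchin_class_def theta_nth)
  \<comment> \<open>Since \<open>k > 0\<close>, the factor \<open>k\<close> keeps this coefficient
    nonzero in \<open>theta f\<close>.\<close>
  obtain k where "k > 0" "fps_nth f k \<noteq> 0"
    using f by (auto simp: khinchin_class_def)
  hence k: "fps_nth f k > 0" "fps_nth (theta f) k > 0"
    using coeff(1)[of k] by (simp_all add: theta_nth)
  have A: "A t > 0" and B: "B t > 0" if "t > 0" for t
    unfolding defs using f k coeff that entire_theta by (blast intro: eval_fps_pos)+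
  have V_top: "filterlim V at_top at_top"
    unfolding V_def by (rule proximate_order_powr_at_top[OF r])
  have V: "V t > 0" if "t > 0" for t
    using that by (simp add: V_def)
  have lnV: "((\<lambda>t. ln (V t) / V t) \<longlongrightarrow> 0) at_top"
    by (rule filterlim_compose[OF ln_x_over_x_tendsto_0 V_top])
  have mean_lim': "((\<lambda>t. B t / A t / V t) \<longlongrightarrow> \<tau> * \<rho>) at_top"
    using mean_lim by (simp add: defs)
  \<comment> \<open>\<open>ln B\<close> is split as \<open>ln A + ln (B/A/V) + ln V\<close>. The
    middle term converges because \<open>\<tau> * \<rho>\<close> is positive, so only
    \<open>ln A\<close> survives division by \<open>V\<close>.\<close>
  have "((\<lambda>t. ln (A t) / V t + ln (B t / A t / V t) / V t + ln (V t) / V t) \<longlongrightarrow> \<tau> + 0 + 0) at_top"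
    using r(2) \<open>\<tau> > 0\<close> ln_lim
    by (intro tendsto_add lnV tendsto_divide_0[OF tendsto_ln[OF mean_lim']]
          filterlim_at_top_imp_at_infinity[OF V_top]) (auto simp: defs)
  moreover have "\<forall>\<^sub>F t in at_top. ln (A t) / V t + ln (B t / A t / V t) / V t + ln (V t) / V t
                   = ln (B t) / V t"
    using eventually_gt_at_top[of 0]
  proof eventually_elim
    case (elim t)
    show ?case
      using A[OF elim] B[OF elim] V[OF elim] by (simp add: ln_div ln_mult field_simps)
  qed
  ultimately have "((\<lambda>t. ln (B t) / V t) \<longlongrightarrow> \<tau>) at_top"
    by (simp add: tendsto_cong)
  hence C_lim: "((\<lambda>t. C t / B t / V t) \<longlongrightarrow> \<tau> * \<rho>) at_top"
    using coeff B r f unfolding defs by (intro theta_quotient_limit entire_theta)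
  have "((\<lambda>t. sqrt (C t / B t / V t / (B t / A t / V t) - 1))
           \<longlongrightarrow> sqrt (\<tau> * \<rho> / (\<tau> * \<rho>) - 1)) at_top"
    using r(2) \<open>\<tau> > 0\<close> by (intro tendsto_intros C_lim mean_lim') auto
  moreover have "\<forall>\<^sub>F t in at_top. sqrt (C t / B t / V t / (B t / A t / V t) - 1)
                   = khinchin_sd f t / khinchin_mean f t"
    using eventually_gt_at_top[of 0]
  proof eventually_elim
    case (elim t)
    note pos = A[OF elim] B[OF elim] V[OF elim]
    have mean: "khinchin_mean f t = B t / A t"
      using khinchin_moments(1)[OF f elim] by (simp add: defs)
    have "khinchin_sd f t / khinchin_mean f t = sqrt ((C t / A t - (B t / A t)\<^sup>2) / (B t / A t)\<^sup>2)"
      using khinchin_moments(2)[OF f elim] pos unfolding mean real_sqrt_divide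
      by (simp add: defs real_sqrt_divide)
    also have "(C t / A t - (B t / A t)\<^sup>2) / (B t / A t)\<^sup>2
                 = C t / B t / V t / (B t / A t / V t) - 1"
      using pos by (simp add: field_simps power2_eq_square)
    finally show ?case ..
  qed
  ultimately have "((\<lambda>t. khinchin_sd f t / khinchin_mean f t) \<longlongrightarrow> 0) at_top"
    using r(2) \<open>\<tau> > 0\<close> by (simp add: tendsto_cong)
  thus ?thesis
    using f by (simp add: clan_def)
qed

theorem theorem5p9:
  fixes f :: "real fps" and \<rho> \<tau> :: real and r :: "real \<Rightarrow> real"
  assumes "f \<in> khinchin_class" and "entire f"
    and "entire_order f = ereal \<rho>" and "\<rho> > 0"
    and "proximate_order \<rho> r" and "\<tau> > 0"
  shows "(((\<lambda>t. ln (eval_fps f t) / t powr r t) \<longlongrightarrow> \<tau>) at_top \<longleftrightarrow>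
          ((\<lambda>t. khinchin_mean f t / t powr r t) \<longlongrightarrow> \<tau> * \<rho>) at_top) \<and>
         (((\<lambda>t. ln (eval_fps f t) / t powr r t) \<longlongrightarrow> \<tau>) at_top \<or>
          ((\<lambda>t. khinchin_mean f t / t powr r t) \<longlongrightarrow> \<tau> * \<rho>) at_top \<longrightarrow> clan f)"
proof -
  have coeff: "fps_nth f n \<ge> 0" "fps_nth f 0 > 0" for n
    using assms(1) by (auto simp: khinchin_class_def)
  have pos: "eval_fps f t > 0" if "t > 0" for t
    using assms(2) coeff that by (blast intro: eval_fps_pos)
  have "\<forall>\<^sub>F t in at_top. khinchin_mean f t / t powr r t
          = eval_fps (theta f) t / eval_fps f t / t powr r t"
    using eventually_gt_at_top[of 0]
    by eventually_elim (simp add: khinchin_moments(1)[OF assms(1,2)])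
  hence mean: "((\<lambda>t. khinchin_mean f t / t powr r t) \<longlongrightarrow> \<tau> * \<rho>) at_top \<longleftrightarrow>
      ((\<lambda>t. eval_fps (theta f) t / eval_fps f t / t powr r t) \<longlongrightarrow> \<tau> * \<rho>) at_top"
    by (rule tendsto_cong)
  \<comment> \<open>\<open>khinchin_clan\<close> takes both limits; whichever one is given, the
    equivalence supplies the other.\<close>
  show ?thesis
    unfolding mean
    using theta_quotient_limit[OF assms(2) coeff(1) pos assms(5)]
      ln_eval_fps_limit[OF assms(2) pos assms(5,4)]
      khinchin_clan[OF assms(1,2,5,4,6)]
    by blast
qed

end
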